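(* Let $\mathcal X$ be a reflexive real Banach space, let $f\in\Gamma_0(\mathcal X)$ be Gâteaux differentiable on $\operatorname{int}\operatorname{dom}f\neq\varnothing$, let $\alpha\in\left]0,+\infty\right[$, let $(f_n)_{n\in\mathbb N}$ be in $\mathcal P_\alpha(f)$, let $(x_n)_{n\in\mathbb N}$ be a sequence in $\operatorname{int}\operatorname{dom}f$, let $C\subset\mathcal X$ be such that $C\cap\operatorname{int}\operatorname{dom}f\neq\varnothing$, and let $x\in C\cap\operatorname{int}\operatorname{dom}f$. Suppose that $(x_n)_{n\in\mathbb N}$ is quasi-Bregman monotone with respect to $C$ relative to $(f_n)_{n\in\mathbb N}$. Then the following hold: (i) $(D^{f_n}(x,x_n))_{n\in\mathbb N}$ converges. (ii) Suppose that $D^f(x,\cdot)$ is coercive. Then $(x_n)_{n\in\mathbb N}$ is bounded.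
   Context: $\langle\cdot,\cdot\rangle$ is the duality pairing between $\mathcal X$ and its dual, $\|\cdot\|$ the norm. $\Gamma_0(\mathcal X)$ is the class of lower semicontinuous convex functions $f\colon\mathcal X\to\left]-\infty,+\infty\right]$ with $\operatorname{dom}f=\{x\mid f(x)<+\infty\}\neq\varnothing$. $\ell^1_+(\mathbb N)$ is the set of summable sequences in $\left[0,+\infty\right[$. A function $h$ is coercive if $h(x)\to+\infty$ as $\|x\|\to+\infty$. Bregman distance: for a convex function $f$ that is Gâteaux differentiable on $\operatorname{int}\operatorname{dom}f\neq\varnothing$, $D^f\colon\mathcal X\times\mathcal X\to[0,+\infty]$ is $D^f(x,y)=f(x)-f(y)-\langle x-y,\nabla f(y)\rangle$ if $y\in\operatorname{int}\operatorname{dom}f$, and $D^f(x,y)=+\infty$ otherwise. $\mathcal F(f)=\{g\in\Gamma_0(\mathcal X)\mid g\text{ is Gâteaux differentiable on }\operatorname{dom}g=\operatorname{int}\operatorname{dom}f\}$. The relation $g_1\succcurlyeq g_2$ means $D^{g_1}(x,y)\geq D^{g_2}(x,y)$ for all $x\in\operatorname{dom}f$ and all $y\in\operatorname{int}\operatorname{dom}f$ (used for elements of $\mathcal F(f)$ and for positive multiples of $f$). $\mathcal P_\alpha(f)=\{g\in\mathcal F(f)\mid g\succcurlyeq\alpha f\}$. Let $(f_n)_{n\in\mathbb N}$ be in $\mathcal F(f)$, $(x_n)_{n\in\mathbb N}$ in $\operatorname{int}\operatorname{dom}f$, and $C\subset\mathcal X$ with $C\cap\operatorname{dom}f\neq\varnothing$.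 $(x_n)$ is quasi-Bregman monotone with respect to $C$ relative to $(f_n)$ if there exists $(\eta_n)_{n\in\mathbb N}\in\ell^1_+(\mathbb N)$ such that for every $x\in C\cap\operatorname{dom}f$ there exists $(\varepsilon_n)_{n\in\mathbb N}\in\ell^1_+(\mathbb N)$ such that for all $n\in\mathbb N$, $D^{f_{n+1}}(x,x_{n+1})\leq(1+\eta_n)D^{f_n}(x,x_n)+\varepsilon_n$. *)

theory Defs
  imports "HOL-Analysis.Analysis"
begin

text \<open>The topological dual of \<^typ>\<open>'a\<close> is the type \<^typ>\<open>'a \<Rightarrow>\<^sub>L real\<close> of bounded linear
  functionals, and \<^const>\<open>blinfun_apply\<close> is the duality pairing.
  Extended-real-valued functions take values in \<^typ>\<open>ereal\<close>.\<close>

text \<open>Surjectivity of the canonical embedding into the bidual.\<close>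

definition reflexive_space :: "'a::real_normed_vector itself \<Rightarrow> bool" where
  "reflexive_space _ \<longleftrightarrow>
     (\<forall>\<phi> :: ('a \<Rightarrow>\<^sub>L real) \<Rightarrow>\<^sub>L real. \<exists>x :: 'a. \<forall>u. blinfun_apply \<phi> u = blinfun_apply u x)"

definition edom :: "('a \<Rightarrow> ereal) \<Rightarrow> 'a set" where
  "edom f = {x. f x < \<infinity>}"

definition lsc :: "('a::topological_space \<Rightarrow> ereal) \<Rightarrow> bool" where
  "lsc f \<longleftrightarrow> (\<forall>x. f x \<le> Liminf (nhds x) f)"

text \<open>Used only for functions that never take the value \<^term>\<open>-\<infinity>\<close>, so that the right-hand
  side is never of the form \<^term>\<open>\<infinity> - \<infinity>\<close>.\<close>

definition convex_ereal :: "('a::real_vector \<Rightarrow> ereal) \<Rightarrow> bool" where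
  "convex_ereal f \<longleftrightarrow>
     (\<forall>x y. \<forall>t::real. 0 < t \<and> t < 1 \<longrightarrow>
        f ((1 - t) *\<^sub>R x + t *\<^sub>R y) \<le> ereal (1 - t) * f x + ereal t * f y)"

definition Gamma0 :: "('a::real_normed_vector \<Rightarrow> ereal) set" where
  "Gamma0 = {f. (\<forall>x. f x \<noteq> -\<infinity>) \<and> lsc f \<and> convex_ereal f \<and> edom f \<noteq> {}}"

text \<open>The difference quotient is taken in \<^typ>\<open>ereal\<close>; since \<^term>\<open>f y\<close> is finite it is
  well defined even where \<^term>\<open>f\<close> is infinite.\<close>

definition has_gateaux_gradient ::
  "('a::real_normed_vector \<Rightarrow> ereal) \<Rightarrow> 'a \<Rightarrow> ('a \<Rightarrow>\<^sub>L real) \<Rightarrow> bool" where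
  "has_gateaux_gradient f y u \<longleftrightarrow>
     \<bar>f y\<bar> \<noteq> \<infinity> \<and>
     (\<forall>h. ((\<lambda>t. (f (y + t *\<^sub>R h) - f y) / ereal t) \<longlongrightarrow> ereal (blinfun_apply u h)) (at 0))"

definition gateaux_differentiable_on ::
  "('a::real_normed_vector \<Rightarrow> ereal) \<Rightarrow> 'a set \<Rightarrow> bool" where
  "gateaux_differentiable_on f S \<longleftrightarrow> (\<forall>y\<in>S. \<exists>u. has_gateaux_gradient f y u)"

definition gateaux_gradient ::
  "('a::real_normed_vector \<Rightarrow> ereal) \<Rightarrow> 'a \<Rightarrow> ('a \<Rightarrow>\<^sub>L real)" where
  "gateaux_gradient f y = (THE u. has_gateaux_gradient f y u)"

lemma gateaux_gradient_eq:
  assumes "has_gateaux_gradient f y u"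
  shows "gateaux_gradient f y = u"
  unfolding gateaux_gradient_def
proof (rule the_equality, rule assms)
  fix v assume v: "has_gateaux_gradient f y v"
  have "blinfun_apply v h = blinfun_apply u h" for h
    using v assms tendsto_unique[OF trivial_limit_at]
    unfolding has_gateaux_gradient_def by (metis ereal.inject)
  then show "v = u" by (rule blinfun_eqI)
qed

definition bregman_distance ::
  "('a::real_normed_vector \<Rightarrow> ereal) \<Rightarrow> 'a \<Rightarrow> 'a \<Rightarrow> ereal" where
  "bregman_distance f x y =
     (if y \<in> interior (edom f)
      then f x - f y - ereal (blinfun_apply (gateaux_gradient f y) (x - y))
      else \<infinity>)"

definition bregman_class ::
  "('a::real_normed_vector \<Rightarrow> ereal) \<Rightarrow> ('a \<Rightarrow> ereal) set" where
  "bregman_class f =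
     {g \<in> Gamma0. edom g = interior (edom f) \<and> gateaux_differentiable_on g (edom g)}"

definition bregman_dominates ::
  "('a::real_normed_vector \<Rightarrow> ereal) \<Rightarrow> ('a \<Rightarrow> ereal) \<Rightarrow> ('a \<Rightarrow> ereal) \<Rightarrow> bool" where
  "bregman_dominates f g1 g2 \<longleftrightarrow>
     (\<forall>x\<in>edom f. \<forall>y\<in>interior (edom f). bregman_distance g1 x y \<ge> bregman_distance g2 x y)"

definition bregman_class_above ::
  "real \<Rightarrow> ('a::real_normed_vector \<Rightarrow> ereal) \<Rightarrow> ('a \<Rightarrow> ereal) set" where
  "bregman_class_above \<alpha> f =
     {g \<in> bregman_class f. bregman_dominates f g (\<lambda>x. ereal \<alpha> * f x)}"

definition l1_nonneg :: "(nat \<Rightarrow> real) set" where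
  "l1_nonneg = {\<xi>. (\<forall>n. 0 \<le> \<xi> n) \<and> summable \<xi>}"

definition quasi_bregman_monotone ::
  "('a::real_normed_vector \<Rightarrow> ereal) \<Rightarrow> 'a set \<Rightarrow> (nat \<Rightarrow> 'a \<Rightarrow> ereal) \<Rightarrow> (nat \<Rightarrow> 'a) \<Rightarrow> bool" where
  "quasi_bregman_monotone f C fs xs \<longleftrightarrow>
     (\<exists>\<eta>\<in>l1_nonneg. \<forall>x\<in>C \<inter> edom f. \<exists>\<epsilon>\<in>l1_nonneg. \<forall>n.
        bregman_distance (fs (Suc n)) x (xs (Suc n))
          \<le> ereal (1 + \<eta> n) * bregman_distance (fs n) x (xs n) + ereal (\<epsilon> n))"

definition coercive :: "('a::real_normed_vector \<Rightarrow> ereal) \<Rightarrow> bool" where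
  "coercive h \<longleftrightarrow> (h \<longlongrightarrow> \<infinity>) at_infinity"

end

theory Submission
  imports Defs
begin

text \<open>By convexity and \<^prop>\<open>x \<in> interior (edom f)\<close>, the distances
  $a_n = D^{f_n}(x, x_n)$ are nonnegative reals, and quasi-monotonicity reads
  $a_{n+1} \<le> (1 + \<eta>_n) a_n + \<epsilon>_n$ with summable $\<eta>$ and $\<epsilon>$. Such sequences
  converge. Since $\<alpha> D^f(x, x_n) \<le> a_n$, the values of $D^f(x, \<cdot>)$ along the sequence are
  bounded, and coercivity bounds the sequence itself.\<close>

lemma quasi_fejer_convergent:
  fixes a :: "nat \<Rightarrow> real"
  assumes "\<eta> \<in> l1_nonneg" "\<epsilon> \<in> l1_nonneg" and a_nonneg: "\<And>n. 0 \<le> a n"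
    and step: "\<And>n. a (Suc n) \<le> (1 + \<eta> n) * a n + \<epsilon> n"
  shows "convergent a"
proof -
  have \<eta>: "0 \<le> \<eta> n" "summable \<eta>" and \<epsilon>: "0 \<le> \<epsilon> n" "summable \<epsilon>" for n
    using assms(1,2) by (auto simp: l1_nonneg_def)
  define P where "P n = (\<Prod>k<n. 1 + \<eta> k)" for n
  define S where "S n = (\<Sum>k<n. \<epsilon> k / P (Suc k))" for n
  define b where "b n = a n / P n - S n" for n
  \<comment> \<open>Dividing by \<^term>\<open>P n\<close> absorbs the factor \<^term>\<open>1 + \<eta> n\<close>;
    subtracting \<^term>\<open>S n\<close> then makes the sequence decreasing.\<close>
  have P_ge_1: "1 \<le> P n" for n
    unfolding P_def by (rule prod_ge_1) (simp add: \<eta>)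
  then have P_pos: "0 < P n" for n
    by (rule less_le_trans[OF zero_less_one])
  have P_Suc: "P (Suc n) = (1 + \<eta> n) * P n" for n
    by (simp add: P_def)
  \<comment> \<open>The bound 1 + t \<le> exp t turns the product into the exponential of a partial
    sum, so summability of \<eta> bounds \<open>P\<close>, which is increasing and therefore
    converges.\<close>
  have "P n \<le> exp (suminf \<eta>)" for n
  proof -
    have "P n \<le> (\<Prod>k<n. exp (\<eta> k))"
      unfolding P_def by (rule prod_mono) (simp add: \<eta> exp_ge_add_one_self)
    also have "\<dots> = exp (\<Sum>k<n. \<eta> k)"
      by (simp add: exp_sum)
    also have "\<dots> \<le> exp (suminf \<eta>)"
      by (simp add: \<eta> sum_le_suminf)
    finally show ?thesis .
  qed
  moreover have "incseq P"
    by (rule incseq_SucI) (use P_pos \<eta> in \<open>simp add: P_Suc algebra_simps less_imp_le\<close>)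
  ultimately obtain p where p: "P \<longlonglongrightarrow> p"
    by (meson incseq_convergent)
  \<comment> \<open>Since \<open>P\<close> is at least 1, the weighted errors are dominated by
    \<epsilon>, and their partial sums \<open>S\<close> converge.\<close>
  have term_le: "0 \<le> \<epsilon> n / P (Suc n)" "\<epsilon> n / P (Suc n) \<le> \<epsilon> n" for n
    using divide_left_mono[OF P_ge_1[of "Suc n"] \<epsilon>(1)[of n]] P_pos[of "Suc n"] \<epsilon>(1)[of n]
    by auto
  have summ: "summable (\<lambda>k. \<epsilon> k / P (Suc k))"
    by (rule summable_comparison_test'[OF \<epsilon>(2), of 0])
      (simp only: real_norm_def abs_of_nonneg[OF term_le(1)] term_le(2))
  then obtain s where s: "S \<longlonglongrightarrow> s"
    unfolding S_def using summable_LIMSEQ by blast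
  have S_le: "S n \<le> (\<Sum>k. \<epsilon> k / P (Suc k))" for n
    unfolding S_def by (rule sum_le_suminf[OF summ]) (use term_le in auto)
  have "decseq b"
  proof (rule decseq_SucI)
    fix n
    have "a (Suc n) / P (Suc n) \<le> ((1 + \<eta> n) * a n + \<epsilon> n) / P (Suc n)"
      by (rule divide_right_mono[OF step]) (use P_pos[of "Suc n"] in simp)
    also have "\<dots> = a n / P n + \<epsilon> n / P (Suc n)"
      using P_pos[of n] \<eta>(1)[of n] by (simp add: P_Suc add_divide_distrib)
    finally show "b (Suc n) \<le> b n"
      by (simp add: b_def S_def)
  qed
  \<comment> \<open>The quotient \<open>a n / P n\<close> is nonnegative, and \<open>S n\<close>
    never exceeds the full sum of its nonnegative terms.\<close>
  moreover have "- (\<Sum>k. \<epsilon> k / P (Suc k)) \<le> b n" for n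
    using S_le[of n] divide_nonneg_pos[OF a_nonneg P_pos, of n n] by (simp add: b_def)
  ultimately obtain l where l: "b \<longlonglongrightarrow> l"
    using decseq_convergent[of b "- (\<Sum>k. \<epsilon> k / P (Suc k))"] by blast
  \<comment> \<open>Undoing the normalization expresses \<open>a\<close> through the three
    convergent sequences \<open>P\<close>, \<open>b\<close> and \<open>S\<close>.\<close>
  have "(\<lambda>n. P n * (b n + S n)) \<longlonglongrightarrow> p * (l + s)"
    by (intro tendsto_intros p l s)
  moreover have "P n * (b n + S n) = a n" for n
    using P_pos[of n] by (simp add: b_def)
  ultimately show ?thesis
    by (auto simp: convergent_def)
qed

lemma Gamma0_finite:
  assumes "g \<in> Gamma0" "z \<in> edom g"
  shows "\<bar>g z\<bar> \<noteq> \<infinity>"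
  using assms by (auto simp: Gamma0_def edom_def)

lemma has_gateaux_gradient_gateaux_gradient:
  assumes "gateaux_differentiable_on g S" "y \<in> S"
  shows "has_gateaux_gradient g y (gateaux_gradient g y)"
  using assms by (auto simp: gateaux_differentiable_on_def dest: gateaux_gradient_eq)

text \<open>On the segment from \<open>y\<close> to \<open>x\<close>, convexity bounds every
  difference quotient with 0 < t < 1 by \<open>g x - g y\<close>; letting t decrease to 0 preserves
  the bound.\<close>

lemma gateaux_gradient_subgradient:
  assumes conv: "convex_ereal g" and u: "has_gateaux_gradient g y u" and x: "\<bar>g x\<bar> \<noteq> \<infinity>"
  shows "ereal (blinfun_apply u (x - y)) \<le> g x - g y"
proof -
  have y: "\<bar>g y\<bar> \<noteq> \<infinity>"
    and lim: "((\<lambda>t. (g (y + t *\<^sub>R (x - y)) - g y) / ereal t)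
      \<longlongrightarrow> ereal (blinfun_apply u (x - y))) (at 0)"
    using u by (auto simp: has_gateaux_gradient_def)
  have quot: "(g (y + t *\<^sub>R (x - y)) - g y) / ereal t \<le> g x - g y" if t: "0 < t" "t < 1" for t
  proof -
    obtain a b where ab: "g x = ereal a" "g y = ereal b"
      using x y by auto
    have "g (y + t *\<^sub>R (x - y)) = g ((1 - t) *\<^sub>R y + t *\<^sub>R x)"
      by (simp add: algebra_simps)
    also have "\<dots> \<le> ereal (1 - t) * g y + ereal t * g x"
      using conv t by (simp add: convex_ereal_def)
    finally have le: "g (y + t *\<^sub>R (x - y)) \<le> ereal ((1 - t) * b + t * a)"
      by (simp add: ab)
    \<comment> \<open>By \<open>le\<close> the value on the segment is not \<infinity>. The value
      -\<infinity> is not excluded by convexity alone, but makes the quotient -\<infinity>.\<close>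
    show ?thesis
      using le t by (cases "g (y + t *\<^sub>R (x - y))") (auto simp: ab field_simps)
  qed
  show ?thesis
  proof (rule tendsto_upperbound)
    \<comment> \<open>The quotient bound holds for positive t only, so the two-sided limit is
      restricted to the right of 0.\<close>
    show "((\<lambda>t. (g (y + t *\<^sub>R (x - y)) - g y) / ereal t)
      \<longlongrightarrow> ereal (blinfun_apply u (x - y))) (at_right 0)"
      by (rule filterlim_mono[OF lim order_refl at_le]) simp
    show "\<forall>\<^sub>F t in at_right 0. (g (y + t *\<^sub>R (x - y)) - g y) / ereal t \<le> g x - g y"
      unfolding eventually_at_right_field using quot by (intro exI[of _ 1]) simp
  qed simp
qed

lemma bregman_distance_finite:
  assumes "\<bar>g x\<bar> \<noteq> \<infinity>" "\<bar>g y\<bar> \<noteq> \<infinity>" "y \<in> interior (edom g)"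
  shows "\<bar>bregman_distance g x y\<bar> \<noteq> \<infinity>"
  using assms by (auto simp: bregman_distance_def)

lemma bregman_distance_nonneg:
  assumes "convex_ereal g" "has_gateaux_gradient g y u" "\<bar>g x\<bar> \<noteq> \<infinity>"
  shows "0 \<le> bregman_distance g x y"
proof -
  have "\<bar>g y\<bar> \<noteq> \<infinity>"
    using assms(2) by (simp add: has_gateaux_gradient_def)
  with gateaux_gradient_subgradient[OF assms] assms(3) show ?thesis
    by (auto simp: bregman_distance_def gateaux_gradient_eq[OF assms(2)])
qed

lemma has_gateaux_gradient_scale:
  assumes "has_gateaux_gradient f y u" "0 < \<alpha>"
  shows "has_gateaux_gradient (\<lambda>z. ereal \<alpha> * f z) y (\<alpha> *\<^sub>R u)"
  unfolding has_gateaux_gradient_def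
proof (intro conjI allI)
  obtain b where b: "f y = ereal b"
    using assms(1) by (auto simp: has_gateaux_gradient_def)
  then show "\<bar>ereal \<alpha> * f y\<bar> \<noteq> \<infinity>"
    by simp
  fix h
  have "((\<lambda>t. ereal \<alpha> * ((f (y + t *\<^sub>R h) - f y) / ereal t))
      \<longlongrightarrow> ereal \<alpha> * ereal (blinfun_apply u h)) (at 0)"
    using assms by (intro tendsto_cmult_ereal) (auto simp: has_gateaux_gradient_def)
  \<comment> \<open>The identity is proved for all t, including t = 0 and points where
    \<open>f\<close> is infinite; there the sign of t decides which infinity the quotient is, and
    positivity of \<alpha> keeps it.\<close>
  moreover have "ereal \<alpha> * ((f (y + t *\<^sub>R h) - f y) / ereal t)
      = (ereal \<alpha> * f (y + t *\<^sub>R h) - ereal \<alpha> * f y) / ereal t" for t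
    using assms(2) by (cases "f (y + t *\<^sub>R h)"; cases "t = 0"; cases "t > 0")
      (auto simp: b divide_ereal_def algebra_simps)
  ultimately show "((\<lambda>t. (ereal \<alpha> * f (y + t *\<^sub>R h) - ereal \<alpha> * f y) / ereal t)
      \<longlongrightarrow> ereal (blinfun_apply (\<alpha> *\<^sub>R u) h)) (at 0)"
    by (simp add: scaleR_blinfun.rep_eq)
qed

lemma edom_scale: "0 < \<alpha> \<Longrightarrow> edom (\<lambda>z. ereal \<alpha> * f z) = edom f"
  by (auto simp: edom_def)

text \<open>Pulling out \<alpha> turns domination of \<alpha> \<open>f\<close> into an upper bound
  on the distance of \<open>f\<close> itself.\<close>

lemma bregman_distance_scale:
  assumes "has_gateaux_gradient f y u" "0 < \<alpha>" "\<bar>f x\<bar> \<noteq> \<infinity>"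
  shows "bregman_distance (\<lambda>z. ereal \<alpha> * f z) x y = ereal \<alpha> * bregman_distance f x y"
proof -
  have "\<bar>f y\<bar> \<noteq> \<infinity>"
    using assms(1) by (simp add: has_gateaux_gradient_def)
  then show ?thesis
    using assms(2,3)
    by (auto simp: bregman_distance_def edom_scale scaleR_blinfun.rep_eq algebra_simps
        gateaux_gradient_eq[OF assms(1)]
        gateaux_gradient_eq[OF has_gateaux_gradient_scale[OF assms(1,2)]])
qed

text \<open>The domain of \<open>g\<close> is exactly the interior of that of \<open>f\<close>: this
  makes \<open>g x\<close> finite, and, being open, puts \<open>y\<close> in the finite branch of
  the distance. Nonnegativity is the gradient inequality.\<close>

lemma bregman_class_distance:
  assumes "g \<in> bregman_class f" "x \<in> interior (edom f)" "y \<in> interior (edom f)"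
  shows "\<bar>bregman_distance g x y\<bar> \<noteq> \<infinity>" "0 \<le> bregman_distance g x y"
proof -
  have g: "g \<in> Gamma0" "edom g = interior (edom f)" "gateaux_differentiable_on g (edom g)"
    using assms(1) by (auto simp: bregman_class_def)
  have xy: "x \<in> edom g" "y \<in> edom g"
    using assms(2,3) by (simp_all only: g(2))
  note fin = Gamma0_finite[OF g(1) xy(1)] Gamma0_finite[OF g(1) xy(2)]
  have "interior (edom g) = edom g"
    by (simp only: g(2) interior_interior)
  then have "y \<in> interior (edom g)"
    using xy(2) by (simp only:)
  then show "\<bar>bregman_distance g x y\<bar> \<noteq> \<infinity>"
    by (rule bregman_distance_finite[OF fin])
  have "convex_ereal g"
    using g(1) by (simp add: Gamma0_def)
  then show "0 \<le> bregman_distance g x y"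
    by (rule bregman_distance_nonneg[OF _ has_gateaux_gradient_gateaux_gradient[OF g(3) xy(2)] fin(1)])
qed

text \<open>Outside some ball \<open>h\<close> exceeds \<open>M\<close>, so no \<open>xs n\<close>
  can lie there.\<close>

lemma bounded_range_coercive:
  fixes h :: "'a::real_normed_vector \<Rightarrow> ereal"
  assumes "coercive h" "\<And>n. h (xs n) \<le> ereal M"
  shows "bounded (range xs)"
proof -
  have "\<forall>\<^sub>F y in at_infinity. ereal M < h y"
    using assms(1) by (simp add: coercive_def order_tendsto_iff)
  then obtain R where R: "\<And>y. R \<le> norm y \<Longrightarrow> ereal M < h y"
    by (auto simp: eventually_at_infinity)
  have "norm (xs n) \<le> R" for n
    using R[of "xs n"] assms(2)[of n] by (meson linear not_less)
  then show ?thesis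
    by (auto simp: bounded_iff)
qed

theorem proposition2p6:
  fixes f :: "'a::banach \<Rightarrow> ereal"
    and \<alpha> :: real
    and fs :: "nat \<Rightarrow> 'a \<Rightarrow> ereal"
    and xs :: "nat \<Rightarrow> 'a"
    and C :: "'a set"
    and x :: 'a
  assumes "reflexive_space TYPE('a)"
    and "f \<in> Gamma0"
    and "interior (edom f) \<noteq> {}"
    and "gateaux_differentiable_on f (interior (edom f))"
    and "\<alpha> > 0"
    and "\<And>n. fs n \<in> bregman_class_above \<alpha> f"
    and "\<And>n. xs n \<in> interior (edom f)"
    and "C \<inter> interior (edom f) \<noteq> {}"
    and "x \<in> C \<inter> interior (edom f)"
    and "quasi_bregman_monotone f C fs xs"
  shows "(\<exists>l::real. (\<lambda>n. bregman_distance (fs n) x (xs n)) \<longlonglongrightarrow> ereal l) \<and>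
         (coercive (\<lambda>y. bregman_distance f x y) \<longrightarrow> bounded (range xs))"
proof -
  define a where "a n = real_of_ereal (bregman_distance (fs n) x (xs n))" for n
  have x: "x \<in> C" "x \<in> interior (edom f)" "x \<in> edom f"
    using assms(9) interior_subset by auto
  have cls: "fs n \<in> bregman_class f"
    and dom: "bregman_dominates f (fs n) (\<lambda>z. ereal \<alpha> * f z)" for n
    using assms(6) by (auto simp: bregman_class_above_def)
  have a: "bregman_distance (fs n) x (xs n) = ereal (a n)" and a_nonneg: "0 \<le> a n" for n
    using bregman_class_distance[OF cls x(2) assms(7), of n n]
    by (cases "bregman_distance (fs n) x (xs n)"; simp add: a_def)+
  \<comment> \<open>The errors \<epsilon> are those attached to this particular \<open>x\<close>,
    which lies in \<open>C\<close> and in the domain of \<open>f\<close>.\<close>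
  obtain \<eta> \<epsilon> where "\<eta> \<in> l1_nonneg" "\<epsilon> \<in> l1_nonneg"
    and step: "\<And>n. bregman_distance (fs (Suc n)) x (xs (Suc n))
      \<le> ereal (1 + \<eta> n) * bregman_distance (fs n) x (xs n) + ereal (\<epsilon> n)"
    using assms(10) x unfolding quasi_bregman_monotone_def by blast
  have "convergent a"
    by (rule quasi_fejer_convergent[OF \<open>\<eta> \<in> l1_nonneg\<close> \<open>\<epsilon> \<in> l1_nonneg\<close> a_nonneg])
      (use step in \<open>simp add: a\<close>)
  then obtain l where l: "a \<longlonglongrightarrow> l"
    by (auto simp: convergent_def)
  have "bounded (range xs)" if coer: "coercive (\<lambda>y. bregman_distance f x y)"
  proof -
    obtain M where M: "a n \<le> M" for n
      using convergent_imp_Bseq[OF \<open>convergent a\<close>] a_nonneg by (fastforce elim!: BseqE)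
    \<comment> \<open>The constant comes from dividing the chain \<alpha> D^f(x, x_n) \<le> a_n
      \<le> M by \<alpha> > 0.\<close>
    have "bregman_distance f x (xs n) \<le> ereal (M / \<alpha>)" for n
    proof -
      have fx: "\<bar>f x\<bar> \<noteq> \<infinity>"
        by (rule Gamma0_finite[OF assms(2) x(3)])
      have "ereal \<alpha> * bregman_distance f x (xs n) = bregman_distance (\<lambda>z. ereal \<alpha> * f z) x (xs n)"
        by (rule bregman_distance_scale[symmetric,
            OF has_gateaux_gradient_gateaux_gradient[OF assms(4,7)] assms(5) fx])
      also have "\<dots> \<le> ereal (a n)"
        using dom[of n] x(3) assms(7)[of n] unfolding bregman_dominates_def a[symmetric] by blast
      also have "\<dots> \<le> ereal M"
        by (simp add: M)
      finally show ?thesis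
        using assms(5) by (cases "bregman_distance f x (xs n)") (auto simp: field_simps)
    qed
    then show ?thesis
      by (rule bounded_range_coercive[OF coer])
  qed
  with l show ?thesis
    by (auto simp: a)
qed

end
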